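(* Let $k\ge1$, $\pi\in S_k$, $i,j\in[k]$, and let $p=(\pi,R)$ with $R=\big([k]\times([k]\setminus\{i\})\big)\cup\{(j,i)\}$ (all rows of boxes fully shaded except row $i$, in which exactly the box $(j,i)$ is shaded). Then for every $n\ge k$, \[ s_n^+(p)=\frac{(n-1)!}{(k-1)!}\qquad\text{and}\qquad\lim_{n\to\infty}\frac{s_n^+(p)}{n!}=0. \]
   Context: For $n\ge1$, $S_n$ is the set of permutations of $\{1,\dots,n\}$ in one-line notation $\tau=\tau_1\cdots\tau_n$. For an integer $k\ge0$ write $[k]=\{0,1,\dots,k\}$. A mesh pattern of length $k$ is a pair $(\pi,R)$ with $\pi\in S_k$ and $R\subseteq[k]\times[k]$; the elements $(x,y)\in R$ are the shaded boxes (box $(x,y)$ is the unit square with south-west corner $(x,y)$ in the plot of the points $(i,\pi_i)$); row $y$ of boxes is $[k]\times\{y\}$. An occurrence of $(\pi,R)$ in $\tau\in S_n$ is a choice of positions $i_1<\dots<i_k$ such that $\tau_{i_a}<\tau_{i_b}$ iff $\pi_a<\pi_b$ for all $a,b$, and such that for every $(x,y)\in R$ there is no index $m$ with $i_x<m<i_{x+1}$ and $v_y<\tau_m<v_{y+1}$, where $i_0=0$, $i_{k+1}=n+1$, $v_0=0$, $v_{k+1}=n+1$, and for $1\le y\le k$, $v_y$ is the $y$-th smallest of the values $\tau_{i_1},\dots,\tau_{i_k}$. A permutation contains a mesh pattern if it has at least one occurrence of it, and $s_n^+(p)$ denotes the number of permutations in $S_n$ containing $p$. *)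

theory Defs
  imports Complex_Main "HOL-Combinatorics.Permutations"
begin

text \<open>
  A permutation in $S_n$ is a function \<open>\<tau> :: nat \<Rightarrow> nat\<close> with \<open>\<tau> permutes {1..n}\<close>;
  its one-line notation is \<open>\<tau> 1, \<dots>, \<tau> n\<close>. Such a function does not determine $n$,
  so the length is always passed explicitly. A mesh pattern of length \<open>k\<close> is given by
  \<open>k\<close>, a \<open>\<pi>\<close> with \<open>\<pi> permutes {1..k}\<close>, and a set \<open>R \<subseteq> {0..k} \<times> {0..k}\<close> of shaded boxes.
\<close>

text \<open>
  The sequence \<open>g 1, \<dots>, g k\<close>, extended by the boundary terms \<open>0\<close> at index \<open>0\<close>
  and \<open>n + 1\<close> at index \<open>k + 1\<close>.
\<close>
definition bordered :: "nat \<Rightarrow> nat \<Rightarrow> (nat \<Rightarrow> nat) \<Rightarrow> nat \<Rightarrow> nat" where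
  "bordered n k g x = (if x = 0 then 0 else if x = k + 1 then n + 1 else g x)"

text \<open>
  The \<open>y\<close>-th smallest element of a finite set, with \<open>y\<close> counted from 1.
\<close>
definition nth_smallest :: "nat set \<Rightarrow> nat \<Rightarrow> nat" where
  "nth_smallest A y = sorted_list_of_set A ! (y - 1)"

text \<open>
  The map \<open>f\<close> lists the positions $i_1 < \dots < i_k$ of the occurrence; only its values
  on \<open>{1..k}\<close> matter.
\<close>
definition mesh_occurrence ::
  "nat \<Rightarrow> (nat \<Rightarrow> nat) \<Rightarrow> (nat \<times> nat) set \<Rightarrow> nat \<Rightarrow> (nat \<Rightarrow> nat) \<Rightarrow> (nat \<Rightarrow> nat) \<Rightarrow> bool" where
  "mesh_occurrence k \<pi> R n \<tau> f \<longleftrightarrow>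
     f ` {1..k} \<subseteq> {1..n} \<and> strict_mono_on {1..k} f \<and>
     (\<forall>a\<in>{1..k}. \<forall>b\<in>{1..k}. \<tau> (f a) < \<tau> (f b) \<longleftrightarrow> \<pi> a < \<pi> b) \<and>
     (let pos = bordered n k f;
          val = bordered n k (nth_smallest (\<tau> ` f ` {1..k}))
      in \<forall>(x, y)\<in>R. \<not> (\<exists>m\<in>{1..n}. pos x < m \<and> m < pos (x + 1) \<and>
                                  val y < \<tau> m \<and> \<tau> m < val (y + 1)))"

definition mesh_contains ::
  "nat \<Rightarrow> (nat \<Rightarrow> nat) \<Rightarrow> (nat \<times> nat) set \<Rightarrow> nat \<Rightarrow> (nat \<Rightarrow> nat) \<Rightarrow> bool" where
  "mesh_contains k \<pi> R n \<tau> \<longleftrightarrow> (\<exists>f. mesh_occurrence k \<pi> R n \<tau> f)"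

text \<open>The number $s_n^+(p)$ for the mesh pattern $p = (\pi, R)$ of length $k$.\<close>
definition num_containing ::
  "nat \<Rightarrow> (nat \<Rightarrow> nat) \<Rightarrow> (nat \<times> nat) set \<Rightarrow> nat \<Rightarrow> nat" where
  "num_containing k \<pi> R n = card {\<tau>. \<tau> permutes {1..n} \<and> mesh_contains k \<pi> R n \<tau>}"

end

theory Submission
  imports Defs "HOL-Library.FuncSet" "HOL-Library.Infinite_Set"
begin

text \<open>
  Full shading of every row except row \<open>i\<close> forces the values of an occurrence to be the \<open>i\<close>
  smallest and the \<open>k - i\<close> largest elements of \<open>{1..n}\<close>. All other points then lie in row \<open>i\<close>,
  so the box \<open>(j, i)\<close> is empty iff the occurrence positions with indices \<open>j\<close> and \<open>j + 1\<close>
  (counting the borders) are adjacent. Hence a permutation has at most one occurrence; there are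
  \<open>(n - 1) choose (k - 1)\<close> choices for its positions and \<open>(n - k)!\<close> ways to place the
  remaining values.
\<close>

section \<open>Increasing sequences of positions and their number\<close>

text \<open>Extensionality makes each sequence of positions a single function, so cardinalities
  count sequences; \<open>mesh_occurrence\<close> leaves the values outside \<open>{1..k}\<close>
  arbitrary.\<close>

definition increasing_maps :: "nat \<Rightarrow> nat \<Rightarrow> (nat \<Rightarrow> nat) set" where
  "increasing_maps k n = {f \<in> {1..k} \<rightarrow>\<^sub>E {1..n}. strict_mono_on {1..k} f}"

lemma nth_smallest_image:
  assumes f: "strict_mono_on {1..k} f" and a: "a \<in> {1..k}"
  shows "nth_smallest (f ` {1..k}) a = f a"
proof -
  let ?l = "map f [1..<Suc k]"
  have s: "sorted_wrt (<) ?l"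
    unfolding sorted_wrt_map
    by (rule sorted_wrt_mono_rel[of _ "(<)"]) (use strict_mono_onD[OF f] in \<open>auto simp del: upt_Suc\<close>)
  have "set ?l = f ` {1..k}" by auto
  moreover have "sorted_list_of_set (set ?l) = ?l"
    using s unfolding strict_sorted_iff by (blast intro: sorted_list_of_set.idem_if_sorted_distinct)
  ultimately have "sorted_list_of_set (f ` {1..k}) = ?l" by simp
  then show ?thesis
    using a unfolding nth_smallest_def by (auto simp del: upt_Suc simp: nth_upt)
qed

text \<open>An increasing map is recovered from its image by \<open>nth_smallest\<close>, so such
  maps correspond to the \<open>k\<close>-element subsets.\<close>

lemma card_increasing_maps: "card (increasing_maps k n) = n choose k"
proof -
  have "bij_betw (\<lambda>f. f ` {1..k}) (increasing_maps k n) {B. B \<subseteq> {1..n} \<and> card B = k}"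
  proof (rule bij_betwI')
    fix f g assume fg: "f \<in> increasing_maps k n" "g \<in> increasing_maps k n"
    show "f ` {1..k} = g ` {1..k} \<longleftrightarrow> f = g"
    proof
      assume e: "f ` {1..k} = g ` {1..k}"
      have "f a = g a" if "a \<in> {1..k}" for a
        using nth_smallest_image[OF _ that, of f] nth_smallest_image[OF _ that, of g] fg e
        by (auto simp: increasing_maps_def)
      then show "f = g"
        using fg by (auto simp: increasing_maps_def intro: PiE_ext)
    qed simp
  next
    fix f assume "f \<in> increasing_maps k n"
    then have "f ` {1..k} \<subseteq> {1..n}" "inj_on f {1..k}"
      by (auto simp: increasing_maps_def strict_mono_on_imp_inj_on)
    then show "f ` {1..k} \<in> {B. B \<subseteq> {1..n} \<and> card B = k}"
      by (auto simp: card_image)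
  next
    fix B assume B: "B \<in> {B. B \<subseteq> {1..n} \<and> card B = k}"
    then have "finite B" using finite_subset by auto
    from this obtain h where h: "bij_betw h {..<card B} B" "strict_mono_on {..<card B} h"
      by (rule ex_bij_betw_strict_mono_card)
    \<comment> \<open>The enumeration \<open>h\<close> starts at index 0; \<open>f\<close> is its
      shift to indices from 1, made extensional.\<close>
    define f where "f = restrict (\<lambda>a. h (a - 1)) {1..k}"
    have shift: "{1..k} = Suc ` {..<k}"
      by (simp add: image_Suc_lessThan)
    have "f ` {1..k} = (\<lambda>a. h (a - 1)) ` {1..k}"
      by (simp add: f_def)
    also have "\<dots> = h ` {..<k}"
      unfolding shift image_image by simp
    finally have "f ` {1..k} = h ` {..<k}" .
    then have fB: "f ` {1..k} = B"
      using bij_betw_imp_surj_on[OF h(1)] B by simp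
    moreover have "strict_mono_on {1..k} f"
    proof (rule strict_mono_onI)
      fix a b assume "a \<in> {1..k}" "b \<in> {1..k}" "a < b"
      then show "f a < f b"
        using strict_mono_onD[OF h(2), of "a - 1" "b - 1"] B by (simp add: f_def)
    qed
    moreover have "f \<in> {1..k} \<rightarrow>\<^sub>E {1..n}"
    proof (rule PiE_I)
      show "f a \<in> {1..n}" if "a \<in> {1..k}" for a using that fB B by blast
      show "f a = undefined" if "a \<notin> {1..k}" for a using that unfolding f_def by (rule restrict_apply[THEN trans, OF if_not_P])
    qed
    ultimately show "\<exists>f\<in>increasing_maps k n. B = f ` {1..k}"
      unfolding increasing_maps_def by blast
  qed
  then show ?thesis
    using n_subsets[of "{1..n}" k] by (simp add: bij_betw_same_card)
qed

section \<open>Sequences with border terms\<close>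

lemma bordered_strict_mono:
  assumes "strict_mono_on {1..k} f" "f ` {1..k} \<subseteq> {1..n}" "a < b" "b \<le> k + 1"
  shows "bordered n k f a < bordered n k f b"
proof -
  have "f c \<in> {1..n}" if "c \<in> {1..k}" for c using assms(2) that by blast
  from this[of a] this[of b] show ?thesis
    using assms strict_mono_onD[OF assms(1), of a b] by (auto simp: bordered_def)
qed

text \<open>Used for positions and for values alike: a point off the occurrence falls into some
  column and some row. The least index whose next term exceeds \<open>m\<close> works, because
  \<open>m\<close> differs from every inner term.\<close>

lemma bordered_between:
  assumes "m \<in> {1..n}" "m \<notin> f ` {1..k}"
  obtains x where "x \<le> k" "bordered n k f x < m" "m < bordered n k f (x + 1)"
proof -
  define x where "x = (LEAST x. m < bordered n k f (x + 1))"
  have k: "m < bordered n k f (k + 1)" using assms by (auto simp: bordered_def)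
  have le: "x \<le> k" unfolding x_def by (rule Least_le) (rule k)
  have up: "m < bordered n k f (x + 1)" unfolding x_def by (rule LeastI) (rule k)
  have "bordered n k f x < m"
  proof (cases x)
    case 0
    then show ?thesis using assms by (simp add: bordered_def)
  next
    case (Suc y)
    then have "y < (LEAST x. m < bordered n k f (x + 1))" by (simp add: x_def)
    from not_less_Least[OF this] have "bordered n k f x \<le> m" using Suc by simp
    moreover have "bordered n k f x = f x" using le Suc by (simp add: bordered_def)
    moreover have "f x \<in> f ` {1..k}" using le Suc by auto
    ultimately show ?thesis using assms(2) by (metis le_neq_implies_less)
  qed
  with le up show ?thesis using that by blast
qed

section \<open>Position sequences with one forced adjacency\<close>

text \<open>They serve as the position sequences of occurrences. For \<open>k >= 1\<close>,
  \<open>j = 0\<close> means starting at position 1 and \<open>j = k\<close> means ending at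
  position \<open>n\<close>.\<close>

definition tight_maps :: "nat \<Rightarrow> nat \<Rightarrow> nat \<Rightarrow> (nat \<Rightarrow> nat) set" where
  "tight_maps k n j =
    {f \<in> increasing_maps k n. bordered n k f (j + 1) = bordered n k f j + 1}"

text \<open>
  Contracting the two adjacent entries with indices \<open>j\<close> and \<open>j + 1\<close> of the bordered sequence
  into one is reversible; bordering makes the extreme cases \<open>j = 0\<close> and \<open>j = k\<close> uniform.
\<close>
lemma card_tight_maps:
  assumes "1 \<le> k" "k \<le> n" "j \<le> k"
  shows "card (tight_maps k n j) = (n - 1) choose (k - 1)"
proof -
  define F where "F f = bordered n k f" for f
  define Q where "Q f = bordered (n - 1) (k - 1) f" for f
  \<comment> \<open>\<open>\<psi>\<close> drops the bordered entry with index \<open>j + 1\<close>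
    and lowers the later ones by 1; \<open>\<phi>\<close> splits entry \<open>j\<close> into two
    neighbours and raises the later ones.\<close>
  define \<psi> where "\<psi> f = restrict (\<lambda>a. if a \<le> j then F f a else F f (a + 1) - 1) {1..k - 1}" for f
  define \<phi> where "\<phi> q = restrict (\<lambda>a. if a \<le> j then Q q a else Q q (a - 1) + 1) {1..k}" for q
  have Fmono: "F f a < F f b" if "f \<in> tight_maps k n j" "a < b" "b \<le> k + 1" for f a b
    using that unfolding F_def
    by (intro bordered_strict_mono) (auto simp: tight_maps_def increasing_maps_def)
  have Qmono: "Q q a < Q q b" if "q \<in> increasing_maps (k - 1) (n - 1)" "a < b" "b \<le> k" for q a b
    using that assms unfolding Q_def
    by (intro bordered_strict_mono) (auto simp: increasing_maps_def)
  have F0: "F f 0 = 0" "F f (k + 1) = n + 1" for f by (auto simp: F_def bordered_def)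
  have Q0: "Q q 0 = 0" "Q q k = n" for q using assms by (auto simp: Q_def bordered_def)
  have Fj: "F f (Suc j) = Suc (F f j)" if "f \<in> tight_maps k n j" for f
    using that by (auto simp: tight_maps_def F_def)
  have Q\<psi>: "Q (\<psi> f) a = (if a \<le> j then F f a else F f (a + 1) - 1)"
    if f: "f \<in> tight_maps k n j" and a: "a \<le> k" for f a
  proof -
    consider "a = 0" | "a = k" "0 < a" | "a \<in> {1..k - 1}" using a assms by force
    then show ?thesis
    proof cases
      case 2
      \<comment> \<open>For \<open>j = k\<close> the first branch applies, and tightness gives
        \<open>F f k = n\<close>, the upper border of the contracted sequence.\<close>
      then show ?thesis using Fj[OF f] F0(2)[of f] Q0 assms by (cases "j = k") auto
    qed (use F0 Q0 assms in \<open>auto simp: Q_def \<psi>_def bordered_def\<close>)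
  qed
  have F\<phi>: "F (\<phi> q) a = (if a \<le> j then Q q a else Q q (a - 1) + 1)"
    if a: "a \<le> k + 1" for q a
  proof -
    consider "a = 0" | "a = k + 1" | "a \<in> {1..k}" using a by force
    then show ?thesis
      by cases (use F0 Q0 assms in \<open>auto simp: F_def \<phi>_def bordered_def\<close>)
  qed
  have \<psi>: "\<psi> f \<in> increasing_maps (k - 1) (n - 1)" if f: "f \<in> tight_maps k n j" for f
  proof -
    have lt: "Q (\<psi> f) a < Q (\<psi> f) b" if ab: "a < b" "b \<le> k" for a b
    proof -
      \<comment> \<open>For \<open>a <= j < b\<close> the intermediate term \<open>F f b\<close>
        absorbs the subtracted 1; for \<open>j < a\<close> the last inequality keeps the truncated
        subtraction exact.\<close>
      have "F f a < F f b" "F f b < F f (Suc b)" "F f (Suc a) < F f (Suc b)" "F f a < F f (Suc a)"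
        using Fmono[OF f] ab by auto
      then show ?thesis using ab by (auto simp: Q\<psi>[OF f])
    qed
    have eq: "\<psi> f a = Q (\<psi> f) a" if "a \<in> {1..k - 1}" for a
      using that by (auto simp: Q_def bordered_def)
    have "\<psi> f a \<in> {1..n - 1}" if a: "a \<in> {1..k - 1}" for a
    proof -
      have "a < k" using a assms by auto
      then show ?thesis using lt[of 0 a] lt[of a k] a eq[OF a] Q0[of "\<psi> f"] by auto
    qed
    then show ?thesis
      unfolding increasing_maps_def
      using lt by (auto simp: strict_mono_on_def eq simp del: One_nat_def) (auto simp: \<psi>_def)
  qed
  have \<phi>: "\<phi> q \<in> tight_maps k n j" if q: "q \<in> increasing_maps (k - 1) (n - 1)" for q
  proof -
    have lt: "F (\<phi> q) a < F (\<phi> q) b" if ab: "a < b" "b \<le> k + 1" for a b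
    proof -
      have "Q q (a - 1) < Q q (b - 1)" if "a \<noteq> 0" using Qmono[OF q] ab that by auto
      \<comment> \<open>This serves \<open>a <= j < b\<close>. There equality means
        \<open>a = j\<close> and \<open>b = j + 1\<close>, the two halves of the split entry, which
        the added 1 separates.\<close>
      moreover have "Q q a \<le> Q q (b - 1)"
      proof (cases "a = b - 1")
        case False
        then have "a < b - 1" "b - 1 \<le> k" using ab by linarith+
        then show ?thesis using Qmono[OF q] by (simp add: less_imp_le)
      qed simp
      moreover have "Q q a < Q q b" if "b \<le> j" using Qmono[OF q] ab assms that by auto
      ultimately show ?thesis using ab by (auto simp: F\<phi>)
    qed
    have eq: "\<phi> q a = F (\<phi> q) a" if "a \<in> {1..k}" for a
      using that by (auto simp: F_def bordered_def)
    have "\<phi> q a \<in> {1..n}" if a: "a \<in> {1..k}" for a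
      using lt[of 0 a] lt[of a "k + 1"] a eq[OF a] F0[of "\<phi> q"] by auto
    then have "\<phi> q \<in> increasing_maps k n"
      unfolding increasing_maps_def
      using lt by (auto simp: strict_mono_on_def eq simp del: One_nat_def) (auto simp: \<phi>_def)
    moreover have "F (\<phi> q) (j + 1) = F (\<phi> q) j + 1"
      using assms by (simp add: F\<phi>)
    ultimately show ?thesis by (simp add: tight_maps_def F_def)
  qed
  have "bij_betw \<psi> (tight_maps k n j) (increasing_maps (k - 1) (n - 1))"
  proof (rule bij_betw_byWitness[where f' = \<phi>])
    show "\<forall>f\<in>tight_maps k n j. \<phi> (\<psi> f) = f"
    proof
      fix f assume f: "f \<in> tight_maps k n j"
      have "\<phi> (\<psi> f) a = f a" if a: "a \<in> {1..k}" for a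
      proof -
        \<comment> \<open>Positivity of \<open>F f a\<close> makes subtracting and adding 1
          lossless; the dropped entry \<open>Suc j\<close> is recovered from tightness.\<close>
        have "F f (a - 1) < F f a" using Fmono[OF f] a by auto
        then have "\<phi> (\<psi> f) a = F f a"
          using a Fj[OF f] Q\<psi>[OF f] by (cases "a = Suc j") (auto simp: \<phi>_def)
        then show ?thesis using a by (auto simp: F_def bordered_def)
      qed
      moreover have "f \<in> {1..k} \<rightarrow>\<^sub>E {1..n}" "\<phi> (\<psi> f) \<in> {1..k} \<rightarrow>\<^sub>E {1..n}"
        using f \<phi>[OF \<psi>[OF f]] by (auto simp: tight_maps_def increasing_maps_def)
      ultimately show "\<phi> (\<psi> f) = f" by (meson PiE_ext)
    qed
    show "\<forall>q\<in>increasing_maps (k - 1) (n - 1). \<psi> (\<phi> q) = q"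
    proof
      fix q assume q: "q \<in> increasing_maps (k - 1) (n - 1)"
      have "\<psi> (\<phi> q) a = q a" if a: "a \<in> {1..k - 1}" for a
      proof -
        have "\<psi> (\<phi> q) a = Q q a" using a by (auto simp: \<psi>_def F\<phi>)
        then show ?thesis using a by (auto simp: Q_def bordered_def)
      qed
      moreover have "q \<in> {1..k - 1} \<rightarrow>\<^sub>E {1..n - 1}" "\<psi> (\<phi> q) \<in> {1..k - 1} \<rightarrow>\<^sub>E {1..n - 1}"
        using q \<psi>[OF \<phi>[OF q]] by (auto simp: increasing_maps_def)
      ultimately show "\<psi> (\<phi> q) = q" by (meson PiE_ext)
    qed
  qed (use \<psi> \<phi> in auto)
  then show ?thesis by (simp add: bij_betw_same_card card_increasing_maps)
qed

section \<open>Permutations with prescribed values\<close>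

text \<open>The solutions form a coset: composing one solution \<open>\<sigma>\<close> on the left
  with the permutations that fix every \<open>f a\<close> yields all of them.\<close>

lemma card_permutes_prescribed:
  assumes S: "finite S" and f: "inj_on f I" "f ` I \<subseteq> S" and u: "inj_on u I" "u ` I \<subseteq> S"
  shows "card {\<tau>. \<tau> permutes S \<and> (\<forall>a\<in>I. \<tau> (f a) = u a)} = fact (card S - card I)"
proof -
  have fin: "finite (f ` I)" "finite (u ` I)" using S f u finite_subset by blast+
  have cards: "card (S - f ` I) = card S - card I" "card (S - u ` I) = card S - card I"
    using f u fin by (simp_all add: card_Diff_subset card_image)
  then obtain h where h: "bij_betw h (S - f ` I) (S - u ` I)"
    using finite_same_card_bij[of "S - f ` I" "S - u ` I"] S by auto
  \<comment> \<open>Prescribed points go where they must, an arbitrary bijection \<open>h\<close>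
    matches the leftover points, and everything outside \<open>S\<close> is fixed.\<close>
  define \<sigma> where "\<sigma> x = (if x \<in> f ` I then u (the_inv_into I f x) else if x \<in> S then h x else x)" for x
  have \<sigma>f: "\<sigma> (f a) = u a" if "a \<in> I" for a
    using that f by (simp add: \<sigma>_def the_inv_into_f_f)
  have "bij_betw \<sigma> (f ` I) (u ` I)"
  proof (rule bij_betw_imageI)
    show "inj_on \<sigma> (f ` I)" using u(1) by (auto simp: inj_on_def \<sigma>f)
    show "\<sigma> ` f ` I = u ` I" by (auto simp: image_image \<sigma>f)
  qed
  moreover have "bij_betw \<sigma> (S - f ` I) (S - u ` I)"
    using h by (subst bij_betw_cong[of _ _ h]) (auto simp: \<sigma>_def)
  ultimately have "bij_betw \<sigma> (f ` I \<union> (S - f ` I)) (u ` I \<union> (S - u ` I))"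
    by (rule bij_betw_combine) auto
  then have "bij_betw \<sigma> S S" using f u by (simp add: Un_absorb1 Un_Diff_cancel)
  then have \<sigma>: "\<sigma> permutes S"
    by (rule bij_imp_permutes) (use f in \<open>auto simp: \<sigma>_def\<close>)
  have "{\<tau>. \<tau> permutes S \<and> (\<forall>a\<in>I. \<tau> (f a) = u a)} = (\<lambda>\<rho>. \<sigma> \<circ> \<rho>) ` {\<rho>. \<rho> permutes (S - f ` I)}"
  proof (intro equalityI subsetI)
    fix \<tau> assume "\<tau> \<in> {\<tau>. \<tau> permutes S \<and> (\<forall>a\<in>I. \<tau> (f a) = u a)}"
    then have \<tau>: "\<tau> permutes S" "\<And>a. a \<in> I \<Longrightarrow> \<tau> (f a) = u a" by auto
    have "(inv \<sigma> \<circ> \<tau>) permutes S"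
      using \<tau> \<sigma> by (simp add: permutes_compose permutes_inv)
    moreover have "(inv \<sigma> \<circ> \<tau>) x = x" if "x \<in> S - (S - f ` I)" for x
    proof -
      from that obtain a where "a \<in> I" "x = f a" by auto
      then show ?thesis using \<tau>(2) \<sigma>f permutes_inverses(2)[OF \<sigma>] by (metis comp_apply)
    qed
    ultimately have "(inv \<sigma> \<circ> \<tau>) permutes (S - f ` I)"
      by (rule permutes_superset)
    moreover have "\<tau> = \<sigma> \<circ> (inv \<sigma> \<circ> \<tau>)"
      using permutes_inverses(1)[OF \<sigma>] by (auto simp: fun_eq_iff)
    ultimately show "\<tau> \<in> (\<lambda>\<rho>. \<sigma> \<circ> \<rho>) ` {\<rho>. \<rho> permutes (S - f ` I)}" by blast
  next
    fix \<tau> assume "\<tau> \<in> (\<lambda>\<rho>. \<sigma> \<circ> \<rho>) ` {\<rho>. \<rho> permutes (S - f ` I)}"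
    then obtain \<rho> where \<rho>: "\<rho> permutes (S - f ` I)" "\<tau> = \<sigma> \<circ> \<rho>" by auto
    have "\<rho> permutes S" using \<rho>(1) by (rule permutes_subset) auto
    then have "\<tau> permutes S" using \<sigma> \<rho> by (simp add: permutes_compose)
    moreover have "\<tau> (f a) = u a" if "a \<in> I" for a
      using that \<rho> \<sigma>f permutes_not_in[OF \<rho>(1), of "f a"] by simp
    ultimately show "\<tau> \<in> {\<tau>. \<tau> permutes S \<and> (\<forall>a\<in>I. \<tau> (f a) = u a)}" by simp
  qed
  moreover have "inj_on (\<lambda>\<rho>. \<sigma> \<circ> \<rho>) {\<rho>. \<rho> permutes (S - f ` I)}"
    using permutes_inj[OF \<sigma>] by (auto simp: inj_on_def fun_eq_iff)
  ultimately show ?thesis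
    using card_permutations[OF cards(1)] S by (simp add: card_image)
qed

section \<open>Characterisation of the occurrences\<close>

text \<open>For \<open>i <= k <= n\<close> this lists the \<open>i\<close> smallest and
  \<open>k - i\<close> largest elements of \<open>{1..n}\<close> in increasing order; at indices 0
  and \<open>k + 1\<close> the same formula gives the border terms.\<close>

definition outer_value :: "nat \<Rightarrow> nat \<Rightarrow> nat \<Rightarrow> nat \<Rightarrow> nat" where
  "outer_value k n i b = (if b \<le> i then b else n - k + b)"

lemma outer_value_mono: "a < b \<Longrightarrow> outer_value k n i a < outer_value k n i b"
  by (auto simp: outer_value_def)

lemma outer_value_less_iff: "outer_value k n i a < outer_value k n i b \<longleftrightarrow> a < b"
  using outer_value_mono[of a b k n i] outer_value_mono[of b a k n i] by (cases a b rule: linorder_cases) auto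

lemma outer_value_strict_mono: "strict_mono_on A (outer_value k n i)"
  by (simp add: strict_mono_on_def outer_value_mono)

lemma outer_value_in: "k \<le> n \<Longrightarrow> b \<in> {1..k} \<Longrightarrow> outer_value k n i b \<in> {1..n}"
  by (auto simp: outer_value_def)

lemma bordered_outer_value:
  "k \<le> n \<Longrightarrow> i \<le> k \<Longrightarrow> b \<le> k + 1 \<Longrightarrow> bordered n k (outer_value k n i) b = outer_value k n i b"
  by (auto simp: outer_value_def bordered_def)

text \<open>This separates values from positions: the values at the chosen positions are prescribed,
  and the box \<open>(j, i)\<close> constrains \<open>f\<close> alone. The count can then be
  factored.\<close>

lemma mesh_occurrence_iff:
  assumes \<pi>: "\<pi> permutes {1..k}" and i: "i \<le> k" and j: "j \<le> k" and kn: "k \<le> n"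
    and R: "R = ({0..k} \<times> ({0..k} - {i})) \<union> {(j, i)}"
    and \<tau>: "\<tau> permutes {1..n}"
  shows "mesh_occurrence k \<pi> R n \<tau> f \<longleftrightarrow>
    f ` {1..k} \<subseteq> {1..n} \<and> strict_mono_on {1..k} f \<and>
    (\<forall>a\<in>{1..k}. \<tau> (f a) = outer_value k n i (\<pi> a)) \<and>
    bordered n k f (j + 1) = bordered n k f j + 1"
    (is "_ \<longleftrightarrow> ?rhs")
proof (cases "f ` {1..k} \<subseteq> {1..n} \<and> strict_mono_on {1..k} f")
  case False
  then show ?thesis by (auto simp: mesh_occurrence_def)
next
  case f: True
  define pos where "pos = bordered n k f"
  define V where "V = \<tau> ` f ` {1..k}"
  define val where "val = bordered n k (nth_smallest V)"
  let ?v = "outer_value k n i"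
  have pos_mono: "pos a < pos b" if "a < b" "b \<le> k + 1" for a b
    using f that unfolding pos_def by (simp add: bordered_strict_mono)
  have VS: "V \<subseteq> {1..n}"
    using f permutes_in_image[OF \<tau>] unfolding V_def by blast
  have pos_out: "m \<notin> f ` {1..k}" if "pos x < m" "m < pos (x + 1)" "x \<le> k" for m x
  proof
    assume "m \<in> f ` {1..k}"
    then obtain a where a: "a \<in> {1..k}" "m = f a" by blast
    then have "m = pos a" by (simp add: pos_def bordered_def)
    moreover have "pos a \<le> pos x" if "a \<le> x"
      using pos_mono[of a x] \<open>x \<le> k\<close> that by (cases "a = x") auto
    moreover have "pos (x + 1) \<le> pos a" if "x + 1 \<le> a"
      using pos_mono[of "x + 1" a] a that by (cases "a = x + 1") auto
    ultimately show False using that by (cases "a \<le> x") auto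
  qed
  have occ: "mesh_occurrence k \<pi> R n \<tau> f \<longleftrightarrow>
     (\<forall>a\<in>{1..k}. \<forall>b\<in>{1..k}. \<tau> (f a) < \<tau> (f b) \<longleftrightarrow> \<pi> a < \<pi> b) \<and>
     (\<forall>(x, y)\<in>R. \<not> (\<exists>m\<in>{1..n}. pos x < m \<and> m < pos (x + 1) \<and> val y < \<tau> m \<and> \<tau> m < val (y + 1)))"
    using f by (auto simp: mesh_occurrence_def Let_def pos_def val_def V_def)
  show ?thesis
  proof
    assume "mesh_occurrence k \<pi> R n \<tau> f"
    then have order: "\<And>a b. a \<in> {1..k} \<Longrightarrow> b \<in> {1..k} \<Longrightarrow> \<tau> (f a) < \<tau> (f b) \<longleftrightarrow> \<pi> a < \<pi> b"
      and empty: "\<And>x y m. (x, y) \<in> R \<Longrightarrow> m \<in> {1..n} \<Longrightarrow> pos x < m \<Longrightarrow> m < pos (x + 1) \<Longrightarrow>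
        val y < \<tau> m \<Longrightarrow> \<tau> m < val (y + 1) \<Longrightarrow> False"
      unfolding occ by blast+
    \<comment> \<open>Reordering by \<open>inv \<pi>\<close> lists the occurrence by increasing
      value, so \<open>g b\<close> is the \<open>b\<close>-th smallest element of
      \<open>V\<close>.\<close>
    define g where "g b = \<tau> (f (inv \<pi> b))" for b
    have inv_in: "inv \<pi> b \<in> {1..k}" if "b \<in> {1..k}" for b
      using that permutes_in_image[OF permutes_inv[OF \<pi>]] by blast
    have g_mono: "strict_mono_on {1..k} g"
      using order inv_in permutes_inverses(1)[OF \<pi>] by (auto simp: strict_mono_on_def g_def simp del: One_nat_def)
    have gV: "g ` {1..k} = V"
    proof -
      have "g ` {1..k} = \<tau> ` f ` (inv \<pi> ` {1..k})" by (auto simp: g_def image_image)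
      also have "inv \<pi> ` {1..k} = {1..k}" using permutes_image[OF permutes_inv[OF \<pi>]] .
      finally show ?thesis by (simp add: V_def)
    qed
    have val_g: "val b = g b" if "b \<in> {1..k}" for b
      using that nth_smallest_image[OF g_mono that] gV by (simp add: val_def bordered_def)
    then have val_b: "val b = bordered n k g b" if "b \<le> k + 1" for b
      using that by (auto simp: val_def bordered_def)
    have val_mono: "val a < val b" if "a < b" "b \<le> k + 1" for a b
      using that bordered_strict_mono[OF g_mono] gV VS by (simp add: val_b)
    have val_le: "val a \<le> val b" if "a \<le> b" "b \<le> k + 1" for a b
      using val_mono[of a b] that by (cases "a = b") auto
    have val0: "val 0 = 0" and valk: "val (k + 1) = n + 1" by (auto simp: val_def bordered_def)
    have step: "val (y + 1) = val y + 1" if y: "y \<le> k" "y \<noteq> i" for y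
    proof (rule ccontr)
      assume "val (y + 1) \<noteq> val y + 1"
      then have c: "val y < val y + 1" "val y + 1 < val (y + 1)"
        using val_mono[of y "y + 1"] y by auto
      \<comment> \<open>The skipped value \<open>val y + 1\<close> is taken at a position off the
        occurrence, hence in some column \<open>x\<close>, and \<open>(x, y)\<close> is
        shaded.\<close>
      define c where "c = val y + 1"
      have cn: "c \<in> {1..n}" using c val_le[of "y + 1" "k + 1"] valk y by (simp add: c_def)
      define m where "m = inv \<tau> c"
      have \<tau>m: "\<tau> m = c" using permutes_inverses(1)[OF \<tau>] by (simp add: m_def)
      have m: "m \<in> {1..n}" using cn permutes_in_image[OF \<tau>, of m] \<tau>m by simp
      have "m \<notin> f ` {1..k}"
      proof
        assume "m \<in> f ` {1..k}"
        then have "c \<in> V" using \<tau>m by (auto simp: V_def)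
        then obtain b where b: "b \<in> {1..k}" "c = val b" using gV val_g by (metis imageE)
        then show False
          using c val_le[of b y] val_le[of "y + 1" b] y by (cases "b \<le> y") (auto simp: c_def)
      qed
      from bordered_between[OF m this] obtain x
        where "x \<le> k" "pos x < m" "m < pos (x + 1)" by (auto simp: pos_def)
      moreover have "(x, y) \<in> R" using R y \<open>x \<le> k\<close> by auto
      ultimately show False using empty[of x y m] m \<tau>m c by (auto simp: c_def)
    qed
    \<comment> \<open>Unit steps are counted up from the border value 0 and down from
      \<open>n + 1\<close>; only the step across row \<open>i\<close> can be larger.\<close>
    have low: "val b = b" if "b \<le> i" for b
      using that by (induction b) (use val0 step i in auto)
    have high: "val b = n - k + b" if "b \<le> k + 1" "i < b" for b
      using that
    proof (induction b rule: inc_induct)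
      case base
      then show ?case using valk kn by simp
    next
      case (step b)
      then show ?case using \<open>\<And>y. y \<le> k \<Longrightarrow> y \<noteq> i \<Longrightarrow> val (y + 1) = val y + 1\<close>[of b] by simp
    qed
    have val_v: "val b = ?v b" if "b \<le> k + 1" for b
      using low high that by (auto simp: outer_value_def)
    have eq: "\<tau> (f a) = ?v (\<pi> a)" if a: "a \<in> {1..k}" for a
    proof -
      have "\<pi> a \<in> {1..k}" using a permutes_in_image[OF \<pi>] by blast
      then have "?v (\<pi> a) = g (\<pi> a)" using val_v[of "\<pi> a"] val_g by auto
      then show ?thesis using permutes_inverses(2)[OF \<pi>] by (simp add: g_def)
    qed
    have "pos (j + 1) = pos j + 1"
    proof (rule ccontr)
      assume "pos (j + 1) \<noteq> pos j + 1"
      then have c: "pos j < pos j + 1" "pos j + 1 < pos (j + 1)"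
        using pos_mono[of j "j + 1"] j by auto
      \<comment> \<open>The point at the position right after \<open>pos j\<close> lies in column
        \<open>j\<close>. Its value is strictly inside some row, necessarily row \<open>i\<close>
        since all others have height 1, so it violates the shading of \<open>(j, i)\<close>.\<close>
      define m where "m = pos j + 1"
      have "pos (j + 1) \<le> n + 1"
        using pos_mono[of "j + 1" "k + 1"] j by (cases "j = k") (auto simp: pos_def bordered_def)
      then have m: "m \<in> {1..n}" using c by (simp add: m_def)
      have out: "m \<notin> f ` {1..k}" using pos_out[of j m] c j by (simp add: m_def)
      have "\<tau> m \<in> {1..n}" using m permutes_in_image[OF \<tau>] by blast
      moreover have "\<tau> m \<notin> V"
        using out permutes_inj[OF \<tau>] by (auto simp: V_def inj_image_mem_iff)
      moreover have "nth_smallest V ` {1..k} = V"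
        using nth_smallest_image[OF g_mono] gV by (metis (no_types, lifting) image_cong)
      ultimately obtain y where y: "y \<le> k" "val y < \<tau> m" "\<tau> m < val (y + 1)"
        using bordered_between[of "\<tau> m" n "nth_smallest V" k] by (metis val_def)
      have "y = i" using step[of y] y by fastforce
      then show False using empty[of j i m] R m y c by (auto simp: m_def)
    qed
    with eq f show ?rhs by (auto simp: pos_def)
  next
    assume ?rhs
    then have eq: "\<And>a. a \<in> {1..k} \<Longrightarrow> \<tau> (f a) = ?v (\<pi> a)" and gap: "pos (j + 1) = pos j + 1"
      by (auto simp: pos_def)
    have "V = ?v ` \<pi> ` {1..k}"
      using eq by (auto simp: V_def image_image)
    then have Vv: "V = ?v ` {1..k}" using permutes_image[OF \<pi>] by simp
    have "val b = bordered n k ?v b" if "b \<le> k + 1" for b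
      using that nth_smallest_image[OF outer_value_strict_mono, of b k k n i]
      by (auto simp: val_def bordered_def Vv)
    then have val: "val b = ?v b" if "b \<le> k + 1" for b
      using bordered_outer_value kn i that by simp
    \<comment> \<open>In row \<open>i\<close> only column \<open>j\<close> is shaded, and it
      contains no position; every other row contains no value.\<close>
    have "\<not> (\<exists>m\<in>{1..n}. pos x < m \<and> m < pos (x + 1) \<and> val y < \<tau> m \<and> \<tau> m < val (y + 1))"
      if "(x, y) \<in> R" for x y
    proof (cases "y = i")
      case True
      then have "x = j" using that R by auto
      then show ?thesis using gap by auto
    next
      case False
      then have "y \<le> k" using that R by auto
      then have "val (y + 1) = val y + 1" using val False by (auto simp: outer_value_def)
      then show ?thesis by auto
    qed
    then show "mesh_occurrence k \<pi> R n \<tau> f"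
      unfolding occ using eq by (auto simp: outer_value_less_iff simp del: One_nat_def)
  qed
qed

section \<open>The count and its limit\<close>

text \<open>The containing permutations are partitioned by their occurrence positions: the binomial
  counts the tight sequences, the factorial the permutations for each one.\<close>

lemma num_containing_eq:
  assumes k: "1 \<le> k" and \<pi>: "\<pi> permutes {1..k}" and i: "i \<le> k" and j: "j \<le> k" and kn: "k \<le> n"
    and R: "R = ({0..k} \<times> ({0..k} - {i})) \<union> {(j, i)}"
  shows "num_containing k \<pi> R n = ((n - 1) choose (k - 1)) * fact (n - k)"
proof -
  let ?v = "outer_value k n i"
  define T where "T f = {\<tau>. \<tau> permutes {1..n} \<and> (\<forall>a\<in>{1..k}. \<tau> (f a) = ?v (\<pi> a))}" for f
  note iff = mesh_occurrence_iff[OF \<pi> i j kn R]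
  have "{\<tau>. \<tau> permutes {1..n} \<and> mesh_contains k \<pi> R n \<tau>} = (\<Union>f\<in>tight_maps k n j. T f)"
  proof (intro equalityI subsetI)
    fix \<tau> assume "\<tau> \<in> {\<tau>. \<tau> permutes {1..n} \<and> mesh_contains k \<pi> R n \<tau>}"
    then obtain f where \<tau>: "\<tau> permutes {1..n}" and f: "mesh_occurrence k \<pi> R n \<tau> f"
      by (auto simp: mesh_contains_def)
    \<comment> \<open>An occurrence may take any values outside \<open>{1..k}\<close>; restriction
      picks its extensional representative.\<close>
    define f' where "f' = restrict f {1..k}"
    have f'f: "f' a = f a" if "a \<in> {1..k}" for a using that by (simp add: f'_def)
    have "bordered n k f' a = bordered n k f a" if "a \<le> k + 1" for a
      using that f'f[of a] by (auto simp: bordered_def)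
    then have "f' \<in> tight_maps k n j"
      using f j unfolding iff[OF \<tau>] tight_maps_def increasing_maps_def
      by (auto simp: strict_mono_on_def f'_def)
    moreover have "\<tau> \<in> T f'" using f \<tau> unfolding iff[OF \<tau>] by (auto simp: T_def f'f)
    ultimately show "\<tau> \<in> (\<Union>f\<in>tight_maps k n j. T f)" by blast
  next
    fix \<tau> assume "\<tau> \<in> (\<Union>f\<in>tight_maps k n j. T f)"
    then obtain f where f: "f \<in> tight_maps k n j" and \<tau>: "\<tau> \<in> T f" by blast
    then have \<tau>': "\<tau> permutes {1..n}" by (simp add: T_def)
    have "mesh_occurrence k \<pi> R n \<tau> f"
      unfolding iff[OF \<tau>'] using f \<tau> by (auto simp: T_def tight_maps_def increasing_maps_def)
    then show "\<tau> \<in> {\<tau>. \<tau> permutes {1..n} \<and> mesh_contains k \<pi> R n \<tau>}"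
      using \<tau>' by (auto simp: mesh_contains_def)
  qed
  moreover have "card (\<Union>f\<in>tight_maps k n j. T f) = (\<Sum>f\<in>tight_maps k n j. card (T f))"
  proof (rule card_UN_disjoint)
    have "finite ({1..k} \<rightarrow>\<^sub>E {1..n})" by (intro finite_PiE) auto
    then show "finite (tight_maps k n j)"
      by (rule finite_subset[rotated]) (auto simp: tight_maps_def increasing_maps_def)
    show "\<forall>f\<in>tight_maps k n j. finite (T f)"
      using finite_permutations[of "{1..n}"] by (auto simp: T_def)
    \<comment> \<open>The prescribed value \<open>?v (\<pi> a)\<close> does not depend on
      \<open>f\<close>, so injectivity of \<open>\<tau>\<close> determines each position.\<close>
    have "f = g" if "f \<in> tight_maps k n j" "g \<in> tight_maps k n j" "\<tau> \<in> T f" "\<tau> \<in> T g" for f g \<tau>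
    proof (rule PiE_ext)
      show "f \<in> {1..k} \<rightarrow>\<^sub>E {1..n}" "g \<in> {1..k} \<rightarrow>\<^sub>E {1..n}"
        using that by (auto simp: tight_maps_def increasing_maps_def)
      fix a assume "a \<in> {1..k}"
      then have "\<tau> (f a) = \<tau> (g a)" and "inj \<tau>"
        using that permutes_inj by (auto simp: T_def)
      then show "f a = g a" by (simp add: inj_eq)
    qed
    then show "\<forall>f\<in>tight_maps k n j. \<forall>g\<in>tight_maps k n j. f \<noteq> g \<longrightarrow> T f \<inter> T g = {}" by blast
  qed
  moreover have "card (T f) = fact (n - k)" if f: "f \<in> tight_maps k n j" for f
  proof -
    have "inj_on f {1..k}" "f ` {1..k} \<subseteq> {1..n}"
      using f by (auto simp: tight_maps_def increasing_maps_def strict_mono_on_imp_inj_on)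
    moreover have "inj_on (\<lambda>a. ?v (\<pi> a)) {1..k}"
      using comp_inj_on[OF permutes_inj_on[OF \<pi>] strict_mono_on_imp_inj_on[OF outer_value_strict_mono]]
      by (simp add: comp_def)
    moreover have "(\<lambda>a. ?v (\<pi> a)) ` {1..k} \<subseteq> {1..n}"
      using outer_value_in[OF kn] permutes_in_image[OF \<pi>] by blast
    ultimately show ?thesis
      using card_permutes_prescribed[of "{1..n}" f "{1..k}" "\<lambda>a. ?v (\<pi> a)"] by (simp add: T_def)
  qed
  ultimately show ?thesis
    using card_tight_maps[OF k kn j] by (simp add: num_containing_def)
qed

theorem theorem3p5:
  fixes k i j :: nat and \<pi> :: "nat \<Rightarrow> nat" and R :: "(nat \<times> nat) set"
  assumes "k \<ge> 1"
    and "\<pi> permutes {1..k}"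
    and "i \<in> {0..k}" and "j \<in> {0..k}"
    and "R = ({0..k} \<times> ({0..k} - {i})) \<union> {(j, i)}"
  shows "(\<forall>n\<ge>k. real (num_containing k \<pi> R n) = fact (n - 1) / fact (k - 1)) \<and>
    (\<lambda>n. real (num_containing k \<pi> R n) / fact n) \<longlonglongrightarrow> 0"
proof
  show count: "\<forall>n\<ge>k. real (num_containing k \<pi> R n) = fact (n - 1) / fact (k - 1)"
  proof (intro allI impI)
    fix n assume n: "k \<le> n"
    then have "n - 1 - (k - 1) = n - k" using assms(1) by simp
    then have "real ((n - 1) choose (k - 1)) = fact (n - 1) / (fact (k - 1) * fact (n - k))"
      using binomial_fact[of "k - 1" "n - 1", where 'a = real] n by simp
    then show "real (num_containing k \<pi> R n) = fact (n - 1) / fact (k - 1)"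
      using num_containing_eq[of k \<pi> i j n R] assms n by simp
  qed
  \<comment> \<open>Cancelling \<open>fact (n - 1)\<close> leaves a constant times
    \<open>1 / n\<close>; the formula is available for \<open>n >= k\<close>, hence the passage
    through eventual equality.\<close>
  have "real (num_containing k \<pi> R n) / fact n = inverse (fact (k - 1)) * inverse (real n)"
    if "n \<ge> k" for n
  proof -
    have "fact n = real n * fact (n - 1)" using assms(1) that by (subst fact_reduce) auto
    moreover have "real (num_containing k \<pi> R n) = fact (n - 1) / fact (k - 1)"
      using count that by blast
    ultimately show ?thesis by (simp add: inverse_eq_divide)
  qed
  then have "eventually (\<lambda>n. inverse (fact (k - 1)) * inverse (real n) =
      real (num_containing k \<pi> R n) / fact n) sequentially"
    by (metis (mono_tags, lifting) eventually_sequentiallyI)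
  moreover have "(\<lambda>n. inverse (fact (k - 1)) * inverse (real n)) \<longlonglongrightarrow> 0"
    by (intro tendsto_mult_right_zero lim_inverse_n)
  ultimately show "(\<lambda>n. real (num_containing k \<pi> R n) / fact n) \<longlonglongrightarrow> 0"
    by (rule Lim_transform_eventually[rotated])
qed

end
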